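(* Let $k$ be a fixed (positive) integer. The function mapping $(1^n)\mapsto\#\mathrm{Av}_n(12\ldots k)$ is in $\#\mathsf{L}$.
   Context: For $\sigma\in S_k$, $\mathrm{Av}_n(\sigma)$ is the set of permutations $w\in S_n$ avoiding the pattern $\sigma$: there are no indices $i_1<i_2<\cdots<i_k$ such that for all $1\le j<l\le k$ one has $w_{i_j}<w_{i_l}\Leftrightarrow\sigma_j<\sigma_l$. Thus $\mathrm{Av}_n(12\ldots k)$ is the set of permutations in $S_n$ whose longest increasing subsequence has length at most $k-1$. The alphabet is $\Sigma=\{0,1\}$; $1^n$ is the string of $n$ ones. A function given only on strings of a displayed form is extended by $0$ to all other strings. $\#\mathsf{L}$ is the class of functions $f:\Sigma^*\to\mathbb{N}_0$ such that $f(x)$ is the number of accepting computation paths on input $x$ of a fixed nondeterministic Turing machine with read-only input tape that uses $O(\log|x|)$ work space and halts on every computation path. Equivalently: there are a polynomial $q$ and a deterministic $O(\log|x|)$-space Turing machine $M$ with an additional read-once, left-to-right witness tape such that $f(x)=\#\{w\in\Sigma^{q(|x|)}\mid M(x,w)=\mathsf{yes}\}$. *)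

theory Defs
  imports Complex_Main "HOL-Library.Landau_Symbols" "HOL-Combinatorics.Permutations"
begin

section \<open>Pattern avoidance\<close>

definition contains_pattern :: "nat \<Rightarrow> (nat \<Rightarrow> nat) \<Rightarrow> nat \<Rightarrow> (nat \<Rightarrow> nat) \<Rightarrow> bool" where
  "contains_pattern n w k \<sigma> \<longleftrightarrow>
    (\<exists>i :: nat \<Rightarrow> nat. strict_mono_on {1..k} i \<and> i ` {1..k} \<subseteq> {1..n} \<and>
      (\<forall>j l. 1 \<le> j \<and> j < l \<and> l \<le> k \<longrightarrow> (w (i j) < w (i l) \<longleftrightarrow> \<sigma> j < \<sigma> l)))"

text \<open>The pattern \<open>\<sigma>\<close> is meant to permute \<open>{1..k}\<close>; the pattern \<open>12\<dots>k\<close> is \<open>id\<close>.\<close>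

definition Av :: "nat \<Rightarrow> nat \<Rightarrow> (nat \<Rightarrow> nat) \<Rightarrow> (nat \<Rightarrow> nat) set" where
  "Av n k \<sigma> = {w. w permutes {1..n} \<and> \<not> contains_pattern n w k \<sigma>}"


section \<open>Functions given on the strings of ones only\<close>

text \<open>Strings over \<open>{0,1}\<close> are lists of booleans, the symbol \<open>1\<close> being \<open>True\<close>.\<close>

definition on_unary :: "(nat \<Rightarrow> nat) \<Rightarrow> bool list \<Rightarrow> nat" where
  "on_unary g x = (if x = replicate (length x) True then g (length x) else 0)"


section \<open>Nondeterministic Turing machines with a read-only input tape\<close>

datatype input_sym = LeftEnd | Bit bool | RightEnd

datatype move = MoveLeft | Stay | MoveRight

fun shift :: "move \<Rightarrow> nat \<Rightarrow> nat" where
  "shift MoveLeft p = p - 1"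
| "shift Stay p = p"
| "shift MoveRight p = Suc p"

text \<open>
  States and work symbols are natural numbers; the blank is \<open>0\<close>. The transition relation
  is a finite set of rules, so only finitely many states and symbols occur in it. There is
  an arbitrary fixed number of work tapes, infinite to the right.
\<close>

record rule =
  source :: nat
  input_read :: input_sym
  work_read :: "nat list"
  target :: nat
  input_move :: move
  work_action :: "(nat \<times> move) list"

record ntm =
  num_tapes :: nat
  start :: nat
  accepting :: "nat set"
  rules :: "rule set"

definition wf_ntm :: "ntm \<Rightarrow> bool" where
  "wf_ntm M \<longleftrightarrow> finite (rules M) \<and>
    (\<forall>r \<in> rules M. length (work_read r) = num_tapes M \<and> length (work_action r) = num_tapes M)"

text \<open>A work tape is given by its contents and the position of its head.\<close>

record config =
  control :: nat
  input_pos :: nat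
  work :: "((nat \<Rightarrow> nat) \<times> nat) list"

definition init_config :: "ntm \<Rightarrow> config" where
  "init_config M = \<lparr>control = start M, input_pos = 1, work = replicate (num_tapes M) (\<lambda>_. 0, 0)\<rparr>"

text \<open>
  The input \<open>x\<close> occupies the positions \<open>1..length x\<close>, delimited by end markers at \<open>0\<close> and
  \<open>length x + 1\<close> that the input head cannot pass: a move beyond them leaves it where it is.
\<close>

definition input_sym_at :: "bool list \<Rightarrow> nat \<Rightarrow> input_sym" where
  "input_sym_at x p =
    (if p = 0 then LeftEnd else if p \<le> length x then Bit (x ! (p - 1)) else RightEnd)"

definition enabled :: "ntm \<Rightarrow> bool list \<Rightarrow> config \<Rightarrow> rule set" where
  "enabled M x c = {r \<in> rules M. source r = control c \<and>
     input_read r = input_sym_at x (input_pos c) \<and>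
     work_read r = map (\<lambda>(T, p). T p) (work c)}"

definition apply_rule :: "bool list \<Rightarrow> config \<Rightarrow> rule \<Rightarrow> config" where
  "apply_rule x c r =
    \<lparr>control = target r,
     input_pos = min (length x + 1) (shift (input_move r) (input_pos c)),
     work = map2 (\<lambda>(T, p) (a, d). (T(p := a), shift d p)) (work c) (work_action r)\<rparr>"

text \<open>
  Computation paths are recorded by the sequence of rules applied, so that different
  nondeterministic choices always give different paths.
\<close>

fun is_run :: "ntm \<Rightarrow> bool list \<Rightarrow> config \<Rightarrow> rule list \<Rightarrow> bool" where
  "is_run M x c [] \<longleftrightarrow> True"
| "is_run M x c (r # rs) \<longleftrightarrow> r \<in> enabled M x c \<and> is_run M x (apply_rule x c r) rs"

definition accepting_paths :: "ntm \<Rightarrow> bool list \<Rightarrow> rule list set" where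
  "accepting_paths M x = {rs. is_run M x (init_config M) rs \<and>
     (let c = foldl (apply_rule x) (init_config M) rs
      in enabled M x c = {} \<and> control c \<in> accepting M)}"

definition halts_on_every_path :: "ntm \<Rightarrow> bool list \<Rightarrow> bool" where
  "halts_on_every_path M x \<longleftrightarrow>
    \<not> (\<exists>\<rho> :: nat \<Rightarrow> rule. \<forall>t. is_run M x (init_config M) (map \<rho> [0..<t]))"

text \<open>
  Heads start at cell \<open>0\<close> and move by at most one cell per step, hence the following says
  that at most \<open>s\<close> cells of each work tape are visited, on any computation path. As the
  number of tapes is fixed, bounding each tape separately only affects constant factors.
\<close>

definition space_bounded :: "ntm \<Rightarrow> bool list \<Rightarrow> nat \<Rightarrow> bool" where
  "space_bounded M x s \<longleftrightarrow>
    (\<forall>rs. is_run M x (init_config M) rs \<longrightarrow>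
      (\<forall>(T, p) \<in> set (work (foldl (apply_rule x) (init_config M) rs)). p < s))"

definition log_space :: "ntm \<Rightarrow> bool" where
  "log_space M \<longleftrightarrow> (\<exists>s :: nat \<Rightarrow> nat. (\<lambda>n. real (s n)) \<in> O(\<lambda>n. ln (real n)) \<and>
    (\<forall>x. space_bounded M x (s (length x))))"

definition sharpL :: "(bool list \<Rightarrow> nat) set" where
  "sharpL = {f. \<exists>M. wf_ntm M \<and> (\<forall>x. halts_on_every_path M x) \<and> log_space M \<and>
    (\<forall>x. f x = card (accepting_paths M x))}"

text \<open>The cardinality in \<open>sharpL\<close> is always that of a finite set (Koenig's lemma).\<close>

lemma finite_accepting_paths:
  assumes "wf_ntm M" "halts_on_every_path M x"
  shows "finite (accepting_paths M x)"
proof (rule ccontr)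
  define runs where "runs c = {rs. is_run M x c rs}" for c
  assume "infinite (accepting_paths M x)"
  then have inf0: "infinite (runs (init_config M))"
    by (rule contrapos_nn, elim rev_finite_subset) (auto simp: runs_def accepting_paths_def)
  have step: "\<exists>r \<in> enabled M x c. infinite (runs (apply_rule x c r))" if "infinite (runs c)" for c
  proof (rule ccontr)
    assume "\<not> ?thesis"
    then have fin: "finite (runs (apply_rule x c r))" if "r \<in> enabled M x c" for r
      using that by blast
    have "finite (enabled M x c)"
      using assms(1) by (auto simp: wf_ntm_def enabled_def)
    then have "finite (\<Union>r \<in> enabled M x c. (#) r ` runs (apply_rule x c r))"
      using fin by blast
    moreover have "runs c \<subseteq> insert [] (\<Union>r \<in> enabled M x c. (#) r ` runs (apply_rule x c r))"
    proof
      fix rs assume "rs \<in> runs c"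
      then show "rs \<in> insert [] (\<Union>r \<in> enabled M x c. (#) r ` runs (apply_rule x c r))"
        by (cases rs) (auto simp: runs_def)
    qed
    ultimately show False
      using that finite_subset by blast
  qed
  then obtain g where g: "g c \<in> enabled M x c" "infinite (runs (apply_rule x c (g c)))"
    if "infinite (runs c)" for c by metis
  define C where "C = rec_nat (init_config M) (\<lambda>_ c. apply_rule x c (g c))"
  have C0: "C 0 = init_config M" and CS: "C (Suc t) = apply_rule x (C t) (g (C t))" for t
    by (simp_all add: C_def)
  have Cinf: "infinite (runs (C t))" for t
    by (induction t) (auto simp: C0 CS inf0 g)
  have "is_run M x (C s) (map (\<lambda>i. g (C i)) [s..<s + t])" for s t
  proof (induction t arbitrary: s)
    case (Suc t)
    have "[s..<s + Suc t] = s # [Suc s..<Suc s + t]"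
      by (simp add: upt_rec)
    then show ?case
      using Suc.IH[of "Suc s"] g(1)[OF Cinf[of s]] by (simp add: CS)
  qed simp
  from this[of 0] have "\<forall>t. is_run M x (init_config M) (map (\<lambda>i. g (C i)) [0..<t])"
    by (simp add: C0)
  then show False
    using assms(2) unfolding halts_on_every_path_def by blast
qed

end

theory Submission
  imports Defs "HOL-Library.Countable" "HOL-Library.Sublist"
    "HOL-Combinatorics.Multiset_Permutations" "HOL-Real_Asymp.Real_Asymp"
begin

text \<open>
  A permutation of \<open>{1..m + 1}\<close> arises in exactly one way from a permutation of \<open>{1..m}\<close>, written
  as a word, by inserting the new maximum at one of the sites \<open>1, \<dots>, m + 1\<close>. For a word of
  length \<open>m\<close> avoiding \<open>12\<dots>k\<close> let \<open>p j\<close> be the length of the shortest prefix containing an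
  increasing subsequence of length \<open>j\<close>, with \<open>p j = m + 1\<close> if there is none; so \<open>p 0 = 0\<close> and
  \<open>p k = m + 1\<close>. If \<open>p i < s \<le> p (i + 1)\<close>, inserting the maximum at site \<open>s\<close> changes
  \<open>p (i + 1)\<close> to \<open>s\<close>, adds one to all later values and keeps the earlier ones; the result avoids
  \<open>12\<dots>k\<close> iff \<open>i + 1 < k\<close>. In terms of the gaps \<open>d i = p (i + 1) - p i\<close>, an insertion
  chooses \<open>i\<close> with \<open>i + 1 < k\<close> and \<open>1 \<le> t \<le> d i\<close>, replaces \<open>d i\<close> by
  \<open>d i - t + 1\<close> and adds \<open>t\<close> to \<open>d (i + 1)\<close>. Hence the number of avoiding permutations is the
  number of sequences of \<open>n\<close> such choices (\<open>card_Av\<close>), and these depend only on the \<open>k\<close>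
  gaps, whose sum is at most \<open>n + 1\<close>.

  The Turing machine keeps the gaps in binary on \<open>k\<close> work tapes. It starts by setting counter \<open>0\<close>
  to one, as the gaps of the empty word are \<open>1, 0, \<dots>, 0\<close>. For each input symbol \<open>1\<close> it
  guesses \<open>i\<close>, then repeatedly decrements counter \<open>i\<close> and increments counter \<open>i + 1\<close>, at least
  once and for a guessed number of times, and finally increments counter \<open>i\<close>. Decrementing a
  counter of value zero blocks the path, as does the input symbol \<open>0\<close>; at the right end marker
  the machine accepts.

  That all paths halt, that the heads stay in a given space, and the number of accepting paths are
  established together, by the inductive predicate \<open>certified\<close>: it is derived
  backwards along the transitions, so that each subroutine of the machine has one lemma, reducing
  a claim on the configuration at its entry to the claim on the configuration at its exit.
\<close>

section \<open>Increasing subsequences under insertion of a maximum\<close>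

lemma subseq_subset: "subseq xs ys \<Longrightarrow> set xs \<subseteq> set ys"
  by (auto simp: subseq_conv_nths dest: in_set_nthsD)

text \<open>The word contains a strictly increasing subsequence of length \<open>j\<close>.\<close>

definition has_incr :: "nat \<Rightarrow> nat list \<Rightarrow> bool" where
  "has_incr j xs \<longleftrightarrow> (\<exists>ys. subseq ys xs \<and> length ys = j \<and> sorted_wrt (<) ys)"

lemma has_incr_0 [simp]: "has_incr 0 xs"
  by (auto simp: has_incr_def)

lemma has_incr_Nil [simp]: "has_incr j [] \<longleftrightarrow> j = 0"
  by (auto simp: has_incr_def)

lemma has_incr_mono: "has_incr j xs \<Longrightarrow> subseq xs ys \<Longrightarrow> has_incr j ys"
  unfolding has_incr_def using subseq_order.order_trans by blast

text \<open>An increasing subsequence that uses the new maximum has to end with it.\<close>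

lemma has_incr_insert_max:
  assumes "\<forall>a \<in> set (us @ vs). a < N"
  shows "has_incr (Suc j) (us @ N # vs) \<longleftrightarrow> has_incr (Suc j) (us @ vs) \<or> has_incr j us"
proof
  assume "has_incr (Suc j) (us @ N # vs)"
  then obtain ys where ys: "subseq ys (us @ N # vs)" "length ys = Suc j" "sorted_wrt (<) ys"
    by (auto simp: has_incr_def)
  then obtain y1 y2 where y: "ys = y1 @ y2" "subseq y1 us" "subseq y2 (N # vs)"
    by (auto simp: subseq_append_iff)
  show "has_incr (Suc j) (us @ vs) \<or> has_incr j us"
  proof (cases "subseq y2 vs")
    case True
    then have "subseq ys (us @ vs)"
      using y by (simp add: list_emb_append_mono)
    then show ?thesis
      using ys unfolding has_incr_def by blast
  next
    case False
    then obtain y3 where y3: "y2 = N # y3" "subseq y3 vs"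
      using y(3) by (cases y2) (auto split: if_splits)
    have "y3 = []"
    proof (rule ccontr)
      assume "y3 \<noteq> []"
      then obtain b where "b \<in> set y3" by (cases y3) auto
      then have "N < b" "b \<in> set vs"
        using ys(3) y y3 by (auto simp: sorted_wrt_append dest: subseq_subset)
      moreover have "b < N"
        using \<open>b \<in> set vs\<close> assms by simp
      ultimately show False by simp
    qed
    then have "length y1 = j" "sorted_wrt (<) y1"
      using ys y y3 by (auto simp: sorted_wrt_append)
    then show ?thesis using y(2) unfolding has_incr_def by blast
  qed
next
  assume "has_incr (Suc j) (us @ vs) \<or> has_incr j us"
  then show "has_incr (Suc j) (us @ N # vs)"
  proof
    assume "has_incr (Suc j) (us @ vs)"
    then show ?thesis
      by (rule has_incr_mono) (auto intro: list_emb_append_mono list_emb_Cons)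
  next
    assume "has_incr j us"
    then obtain ys where ys: "subseq ys us" "length ys = j" "sorted_wrt (<) ys"
      by (auto simp: has_incr_def)
    have "subseq (ys @ [N]) (us @ N # vs)"
      using ys(1) by (intro list_emb_append_mono) auto
    moreover have "sorted_wrt (<) (ys @ [N])"
      using ys assms subseq_subset by (fastforce simp: sorted_wrt_append)
    ultimately show ?thesis
      using ys(2) unfolding has_incr_def by (metis length_append_singleton)
  qed
qed

text \<open>
  The \<open>d i\<close> with \<open>i < k\<close> are the differences of consecutive values among
  \<open>p 0, \<dots>, p k\<close>, where \<open>p j\<close> is the length of the shortest prefix with an increasing
  subsequence of length \<open>j\<close>. The first conjunct, \<open>p k = length xs + 1\<close>, says that
  the word avoids \<open>12\<dots>k\<close>.
\<close>

definition gaps :: "nat \<Rightarrow> nat list \<Rightarrow> (nat \<Rightarrow> nat) \<Rightarrow> bool" where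
  "gaps k xs d \<longleftrightarrow> (\<Sum>i<k. d i) = Suc (length xs) \<and>
    (\<forall>j\<le>k. \<forall>m\<le>length xs. has_incr j (take m xs) \<longleftrightarrow> (\<Sum>i<j. d i) \<le> m)"

text \<open>The letter \<open>N\<close> becomes the letter number \<open>s\<close> of the word, counting from one.\<close>

definition insert_at :: "nat \<Rightarrow> nat \<Rightarrow> nat list \<Rightarrow> nat list" where
  "insert_at s N xs = take (s - 1) xs @ N # drop (s - 1) xs"

lemma length_insert_at [simp]: "length (insert_at s N xs) = Suc (length xs)"
  by (simp add: insert_at_def)

lemma has_incr_take_insert_at:
  assumes "1 \<le> s" "s \<le> Suc (length xs)" "\<forall>a\<in>set xs. a < N"
  shows "has_incr (Suc j) (take m (insert_at s N xs)) \<longleftrightarrow>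
    (if m < s then has_incr (Suc j) (take m xs)
     else has_incr (Suc j) (take (m - 1) xs) \<or> has_incr j (take (s - 1) xs))"
proof (cases "m < s")
  case True
  then have "m \<le> s - 1" by simp
  then show ?thesis
    using True assms by (simp add: insert_at_def min_def)
next
  case False
  then obtain l where l: "m = s + l"
    by (metis le_Suc_ex not_less)
  \<comment> \<open>The prefix of length \<open>m\<close> contains the new maximum and \<open>l\<close> letters after it.\<close>
  have 1: "take m (insert_at s N xs) = take (s - 1) xs @ N # take l (drop (s - 1) xs)"
    using assms l by (simp add: insert_at_def min_def Suc_diff_le)
  have 2: "take (m - 1) xs = take (s - 1) xs @ take l (drop (s - 1) xs)"
    using l assms(1) by (simp add: take_add [symmetric])
  have 3: "\<forall>a \<in> set (take (s - 1) xs @ take l (drop (s - 1) xs)). a < N"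
    using assms(3) by (auto dest: in_set_takeD in_set_dropD)
  show ?thesis
    using False has_incr_insert_max[OF 3] unfolding 1 2 by simp
qed

section \<open>The tree of insertions\<close>

text \<open>
  The number of sequences of \<open>r\<close> insertions from the gaps \<open>d\<close>. Only the gaps
  \<open>d 0, \<dots>, d (k - 1)\<close> matter.
\<close>

fun tree_count :: "nat \<Rightarrow> nat \<Rightarrow> (nat \<Rightarrow> nat) \<Rightarrow> nat" where
  "tree_count k 0 d = 1"
| "tree_count k (Suc r) d =
    (\<Sum>i\<in>{i. Suc i < k}. \<Sum>t\<in>{1..d i}. tree_count k r (d(i := d i - t + 1, Suc i := d (Suc i) + t)))"

text \<open>The effect of an insertion on the partial sums \<open>p j\<close> of the gaps.\<close>

lemma sum_transfer:
  fixes d :: "nat \<Rightarrow> nat"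
  assumes "1 \<le> t" "t \<le> d i"
  shows "(\<Sum>l<j. (d(i := d i - t + 1, Suc i := d (Suc i) + t)) l) =
    (if j \<le> i then \<Sum>l<j. d l else if j = Suc i then (\<Sum>l<Suc i. d l) + 1 - t
     else (\<Sum>l<j. d l) + 1)"
proof -
  let ?e = "d(i := d i - t + 1, Suc i := d (Suc i) + t)"
  have a: "(\<Sum>l<j. ?e l) = (\<Sum>l<j. d l)" if "j \<le> i" for j
    using that by (intro sum.cong) auto
  have b: "(\<Sum>l<Suc i. ?e l) = (\<Sum>l<Suc i. d l) + 1 - t"
    using a[of i] assms by simp
  have c: "(\<Sum>l<Suc (Suc i) + m. ?e l) = (\<Sum>l<Suc (Suc i) + m. d l) + 1" for m
  proof (induction m)
    case 0
    have "(\<Sum>l<Suc (Suc i). ?e l) = (\<Sum>l<Suc i. ?e l) + d (Suc i) + t"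
      by simp
    then show ?case
      unfolding b using assms by simp
  qed simp
  consider "j \<le> i" | "j = Suc i" | "Suc (Suc i) \<le> j" by linarith
  then show ?thesis
  proof cases
    case 3
    then have "j = Suc (Suc i) + (j - Suc (Suc i))" by simp
    then show ?thesis using 3 c[of "j - Suc (Suc i)"] by simp
  qed (use a b in simp_all)
qed

text \<open>The site \<open>s = p (i + 1) + 1 - t\<close> lies in the interval from \<open>p i + 1\<close> to \<open>p (i + 1)\<close>.\<close>

lemma gaps_insert_at:
  assumes g: "gaps k xs d" and N: "\<forall>a\<in>set xs. a < N" and t: "1 \<le> t" "t \<le> d i"
    and i: "Suc i < k" and s: "s = (\<Sum>l<Suc i. d l) + 1 - t"
  shows "gaps k (insert_at s N xs) (d(i := d i - t + 1, Suc i := d (Suc i) + t))"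
proof -
  let ?e = "d(i := d i - t + 1, Suc i := d (Suc i) + t)"
  have mono: "(\<Sum>l<a. d l) \<le> (\<Sum>l<b. d l)" if "a \<le> b" for a b
    using that by (intro sum_mono2) auto
  have tot: "(\<Sum>l<k. d l) = Suc (length xs)"
    using g by (simp add: gaps_def)
  have lo: "(\<Sum>l<i. d l) < s" and hi: "s \<le> (\<Sum>l<Suc i. d l)"
    using s t by auto
  have s1: "1 \<le> s" and s2: "s \<le> Suc (length xs)"
    using lo hi mono[of "Suc i" k] i tot by auto
  have "(\<Sum>l<k. ?e l) = Suc (length (insert_at s N xs))"
    using sum_transfer[of t d i, OF t, of k] i tot by simp
  moreover have "has_incr j (take m (insert_at s N xs)) \<longleftrightarrow> (\<Sum>l<j. ?e l) \<le> m"
    if j: "j \<le> k" and m: "m \<le> Suc (length xs)" for j m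
  proof (cases j)
    case (Suc j')
    have G: "has_incr a (take b xs) \<longleftrightarrow> (\<Sum>l<a. d l) \<le> b" if "a \<le> k" "b \<le> length xs" for a b
      using g that by (simp add: gaps_def)
    have "has_incr j (take m (insert_at s N xs)) \<longleftrightarrow>
      (if m < s then (\<Sum>l<j. d l) \<le> m else (\<Sum>l<j. d l) \<le> m - 1 \<or> (\<Sum>l<j'. d l) \<le> s - 1)"
      using j m s1 s2 G[of j m] G[of j "m - 1"] G[of j' "s - 1"]
      unfolding Suc has_incr_take_insert_at[OF s1 s2 N] by auto
    also have "\<dots> \<longleftrightarrow> (\<Sum>l<j. ?e l) \<le> m"
    proof -
      consider "j \<le> i" | "j = Suc i" | "Suc (Suc i) \<le> j" by linarith
      then show ?thesis
      proof cases
        case 1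
        then show ?thesis
          using mono[of j i] mono[of j' i] lo Suc sum_transfer[of t d i, OF t, of j] by auto
      next
        case 2
        then show ?thesis
          using lo hi Suc s sum_transfer[of t d i, OF t, of j] by auto
      next
        case 3
        then show ?thesis
          using mono[of "Suc i" j'] mono[of "Suc i" j] hi s1 Suc sum_transfer[of t d i, OF t, of j] by auto
      qed
    qed
    finally show ?thesis .
  qed simp
  ultimately show ?thesis
    by (simp add: gaps_def)
qed

lemma has_incr_insert_at_last_gap:
  assumes g: "gaps (Suc i) xs d" and N: "\<forall>a\<in>set xs. a < N"
    and s: "(\<Sum>l<i. d l) < s" "s \<le> (\<Sum>l<Suc i. d l)"
  shows "has_incr (Suc i) (insert_at s N xs)"
proof -
  have s1: "1 \<le> s" and s2: "s \<le> Suc (length xs)"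
    using s g by (auto simp: gaps_def)
  have "has_incr i (take (s - 1) xs)"
    using g s s2 by (auto simp: gaps_def)
  then show ?thesis
    using has_incr_take_insert_at[OF s1 s2 N, of i "Suc (length xs)"] s2 by simp
qed

text \<open>The sites are grouped by the interval between consecutive \<open>p i\<close> that contains them.\<close>

lemma sum_by_gaps:
  fixes d g :: "nat \<Rightarrow> nat"
  shows "(\<Sum>s\<in>{1..\<Sum>l<k. d l}. g s) = (\<Sum>i<k. \<Sum>t\<in>{1..d i}. g ((\<Sum>l<Suc i. d l) + 1 - t))"
proof (induction k)
  case (Suc k)
  let ?p = "\<Sum>l<k. d l"
  have "(\<Sum>s\<in>{1..?p + d k}. g s) = (\<Sum>s\<in>{1..?p}. g s) + (\<Sum>s\<in>{?p<..?p + d k}. g s)"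
    by (subst sum.union_disjoint [symmetric]) (auto intro: sum.cong)
  also have "(\<Sum>s\<in>{?p<..?p + d k}. g s) = (\<Sum>t\<in>{1..d k}. g (?p + d k + 1 - t))"
    by (rule sum.reindex_bij_witness[where i = "\<lambda>t. ?p + d k + 1 - t" and j = "\<lambda>s. ?p + d k + 1 - s"])
      auto
  finally show ?case
    using Suc.IH by simp
qed simp

text \<open>
  The permutations, as words, that avoid \<open>12\<dots>k\<close> and arise from the permutation \<open>xs\<close> by \<open>r\<close>
  insertions of a new maximum: deleting the \<open>r\<close> largest letters gives \<open>xs\<close> back.
\<close>

definition ext :: "nat \<Rightarrow> nat \<Rightarrow> nat list \<Rightarrow> nat list set" where
  "ext k r xs = {ys \<in> permutations_of_set {1..length xs + r}.
     filter (\<lambda>a. a \<le> length xs) ys = xs \<and> \<not> has_incr k ys}"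

lemma finite_ext [simp]: "finite (ext k r xs)"
  by (simp add: ext_def)

lemma inj_insert_at:
  assumes "N \<notin> set xs"
  shows "inj_on (\<lambda>s. insert_at s N xs) {1..Suc (length xs)}"
proof (rule inj_onI)
  fix a b assume ab: "a \<in> {1..Suc (length xs)}" "b \<in> {1..Suc (length xs)}"
    "insert_at a N xs = insert_at b N xs"
  \<comment> \<open>The site is recovered from the letters before the first occurrence of \<open>N\<close>.\<close>
  have "takeWhile (\<lambda>y. y \<noteq> N) (insert_at s N xs) = take (s - 1) xs" for s
    using assms by (auto simp: insert_at_def takeWhile_tail intro!: takeWhile_append2 [THEN trans]
        dest: in_set_takeD)
  then have "length (take (a - 1) xs) = length (take (b - 1) xs)"
    using ab(3) by metis
  then show "a = b" using ab by auto
qed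

lemma ext_Suc:
  assumes "xs \<in> permutations_of_set {1..length xs}"
  shows "ext k (Suc r) xs = (\<Union>s\<in>{1..Suc (length xs)}. ext k r (insert_at s (Suc (length xs)) xs))"
proof (intro equalityI subsetI)
  let ?N = "Suc (length xs)"
  fix ys assume "ys \<in> ext k (Suc r) xs"
  then have ys: "set ys = {1..?N + r}" "distinct ys" "filter (\<lambda>a. a < ?N) ys = xs" "\<not> has_incr k ys"
    by (auto simp: ext_def permutations_of_set_def less_Suc_eq_le)
  \<comment> \<open>The site is the position of the letter \<open>length xs + 1\<close> among the letters not exceeding it.\<close>
  define zs where "zs = filter (\<lambda>a. a \<le> ?N) ys"
  have "?N \<in> set zs"
    using ys(1) by (auto simp: zs_def)
  then obtain us vs where uv: "zs = us @ ?N # vs"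
    by (auto simp: in_set_conv_decomp)
  have dz: "distinct zs"
    using ys(2) by (simp add: zs_def)
  have "filter (\<lambda>a. a < ?N) zs = xs"
    using ys(3) by (simp add: zs_def conj_commute) (metis (mono_tags, lifting) filter_cong less_le)
  moreover have "filter (\<lambda>a. a < ?N) us = us" "filter (\<lambda>a. a < ?N) vs = vs"
  proof -
    have "a < ?N" if "a \<in> set us \<union> set vs" for a
    proof -
      have "a \<in> set zs" "a \<noteq> ?N" using that uv dz by auto
      then show ?thesis by (auto simp: zs_def)
    qed
    then show "filter (\<lambda>a. a < ?N) us = us" "filter (\<lambda>a. a < ?N) vs = vs"
      by (auto simp: filter_id_conv)
  qed
  ultimately have "xs = us @ vs"
    by (simp add: uv)
  then have "zs = insert_at (Suc (length us)) ?N xs" "Suc (length us) \<in> {1..?N}"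
    by (auto simp: uv insert_at_def)
  moreover have "ys \<in> ext k r zs"
  proof -
    have "length zs = ?N" using \<open>xs = us @ vs\<close> uv by simp
    then show ?thesis
      using ys by (simp add: ext_def permutations_of_set_def zs_def)
  qed
  ultimately show "ys \<in> (\<Union>s\<in>{1..?N}. ext k r (insert_at s ?N xs))"
    by blast
next
  let ?N = "Suc (length xs)"
  fix ys assume "ys \<in> (\<Union>s\<in>{1..?N}. ext k r (insert_at s ?N xs))"
  then obtain s where s: "s \<in> {1..?N}" "ys \<in> permutations_of_set {1..?N + r}"
    "filter (\<lambda>a. a \<le> ?N) ys = insert_at s ?N xs" "\<not> has_incr k ys"
    by (auto simp: ext_def)
  have "filter (\<lambda>a. a \<le> length xs) ys = filter (\<lambda>a. a \<le> length xs) (filter (\<lambda>a. a \<le> ?N) ys)"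
    by simp (metis (mono_tags, lifting) le_SucI)
  also have "\<dots> = filter (\<lambda>a. a \<le> length xs) xs"
    unfolding s(3) by (simp add: insert_at_def) (metis append_take_drop_id filter_append)
  also have "\<dots> = xs"
    using assms by (auto simp: filter_id_conv permutations_of_set_def)
  finally show "ys \<in> ext k (Suc r) xs"
    using s by (simp add: ext_def)
qed

lemma ext_empty:
  assumes "has_incr k xs"
  shows "ext k r xs = {}"
proof -
  have "has_incr k ys" if "filter (\<lambda>a. a \<le> length xs) ys = xs" for ys
    using assms that by (metis has_incr_mono subseq_filter_left)
  then show ?thesis by (auto simp: ext_def)
qed

lemma insert_at_permutations:
  assumes "xs \<in> permutations_of_set {1..length xs}"
  shows "insert_at s (Suc (length xs)) xs \<in> permutations_of_set {1..Suc (length xs)}"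
proof -
  have "set (take (s - 1) xs) \<union> set (drop (s - 1) xs) = set xs"
    by (metis append_take_drop_id set_append)
  moreover have "set (take (s - 1) xs) \<inter> set (drop (s - 1) xs) = {}"
    using assms by (simp add: permutations_of_set_def set_take_disj_set_drop_if_distinct)
  ultimately show ?thesis
    using assms by (auto simp: permutations_of_set_def insert_at_def dest: in_set_takeD in_set_dropD)
qed

lemma card_ext:
  assumes "xs \<in> permutations_of_set {1..length xs}" "gaps (Suc k) xs d"
  shows "card (ext (Suc k) r xs) = tree_count (Suc k) r d"
  using assms
proof (induction r arbitrary: xs d)
  case 0
  then have "\<not> has_incr (Suc k) xs" "filter (\<lambda>a. a \<le> length xs) xs = xs"
    using 0(2)[unfolded gaps_def, THEN conjunct2, rule_format, of "Suc k" "length xs"]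
    by (auto simp: gaps_def permutations_of_set_def filter_id_conv)
  moreover have "ys = xs" if "set ys = {1..length xs}" "filter (\<lambda>a. a \<le> length xs) ys = xs" for ys
    using that by (metis atLeastAtMost_iff filter_True)
  ultimately have "ext (Suc k) 0 xs = {xs}"
    using 0 by (auto simp: ext_def permutations_of_set_def)
  then show ?case by simp
next
  case (Suc r)
  let ?N = "Suc (length xs)"
  have lt: "\<forall>a\<in>set xs. a < ?N"
    using Suc.prems(1) by (auto simp: permutations_of_set_def)
  have inj: "inj_on (\<lambda>s. insert_at s ?N xs) {1..?N}"
    using lt by (intro inj_insert_at) auto
  have "card (ext (Suc k) (Suc r) xs) = (\<Sum>s\<in>{1..?N}. card (ext (Suc k) r (insert_at s ?N xs)))"
    unfolding ext_Suc[OF Suc.prems(1)]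
  proof (rule card_UN_disjoint)
    show "\<forall>a\<in>{1..?N}. \<forall>b\<in>{1..?N}. a \<noteq> b \<longrightarrow>
      ext (Suc k) r (insert_at a ?N xs) \<inter> ext (Suc k) r (insert_at b ?N xs) = {}"
      using inj by (fastforce simp: ext_def inj_on_def)
  qed auto
  also have "?N = (\<Sum>l<Suc k. d l)"
    using Suc.prems(2) by (simp add: gaps_def)
  also have "(\<Sum>s\<in>{1..\<Sum>l<Suc k. d l}. card (ext (Suc k) r (insert_at s (\<Sum>l<Suc k. d l) xs))) =
    (\<Sum>i<Suc k. \<Sum>t\<in>{1..d i}.
       card (ext (Suc k) r (insert_at ((\<Sum>l<Suc i. d l) + 1 - t) (\<Sum>l<Suc k. d l) xs)))"
    by (rule sum_by_gaps)
  also have "(\<Sum>l<Suc k. d l) = ?N"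
    using Suc.prems(2) by (simp add: gaps_def)
  also have "(\<Sum>i<Suc k. \<Sum>t\<in>{1..d i}.
       card (ext (Suc k) r (insert_at ((\<Sum>l<Suc i. d l) + 1 - t) ?N xs))) =
     (\<Sum>i<k. \<Sum>t\<in>{1..d i}.
       card (ext (Suc k) r (insert_at ((\<Sum>l<Suc i. d l) + 1 - t) ?N xs)))"
  proof -
    have "ext (Suc k) r (insert_at ((\<Sum>l<Suc k. d l) + 1 - t) ?N xs) = {}"
      if "t \<in> {1..d k}" for t
      using that by (intro ext_empty has_incr_insert_at_last_gap[OF Suc.prems(2) lt]) auto
    then show ?thesis by simp
  qed
  also have "\<dots> = (\<Sum>i<k. \<Sum>t\<in>{1..d i}. tree_count (Suc k) r (d(i := d i - t + 1, Suc i := d (Suc i) + t)))"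
  proof (intro sum.cong refl)
    fix i t assume "i \<in> {..<k}" "t \<in> {1..d i}"
    then show "card (ext (Suc k) r (insert_at ((\<Sum>l<Suc i. d l) + 1 - t) ?N xs)) =
      tree_count (Suc k) r (d(i := d i - t + 1, Suc i := d (Suc i) + t))"
      using insert_at_permutations[OF Suc.prems(1)] lt
      by (intro Suc.IH gaps_insert_at[OF Suc.prems(2)]) auto
  qed
  also have "\<dots> = tree_count (Suc k) (Suc r) d"
    by (simp add: lessThan_def)
  finally show ?case .
qed

section \<open>Counting the avoiding permutations\<close>

lemma contains_pattern_iff_incr:
  "contains_pattern n w k id \<longleftrightarrow> has_incr k (map w [1..<Suc n])"
proof
  assume "contains_pattern n w k id"
  then obtain i where i: "strict_mono_on {1..k} i" "i ` {1..k} \<subseteq> {1..n}"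
    "\<And>j l. 1 \<le> j \<Longrightarrow> j < l \<Longrightarrow> l \<le> k \<Longrightarrow> w (i j) < w (i l)"
    unfolding contains_pattern_def by auto
  have "map i [1..<Suc k] = filter (\<lambda>a. a \<in> i ` {1..k}) [1..<Suc n]"
  proof (rule sorted_distinct_set_unique)
    show "sorted (map i [1..<Suc k])"
      using i(1) by (auto simp: strict_mono_on_def sorted_wrt_iff_nth_less less_imp_le simp del: upt_Suc)
    show "distinct (map i [1..<Suc k])"
      using strict_mono_on_imp_inj_on[OF i(1)] by (simp add: distinct_map atLeastLessThanSuc_atLeastAtMost del: upt_Suc)
    show "set (map i [1..<Suc k]) = set (filter (\<lambda>a. a \<in> i ` {1..k}) [1..<Suc n])"
      using i(2) by (auto simp: atLeastLessThanSuc_atLeastAtMost simp del: upt_Suc)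
  qed (auto simp: sorted_wrt_filter simp del: upt_Suc)
  then have "subseq (map i [1..<Suc k]) [1..<Suc n]"
    by (simp del: upt_Suc)
  then have "subseq (map w (map i [1..<Suc k])) (map w [1..<Suc n])"
    by (rule subseq_map)
  moreover have "sorted_wrt (<) (map w (map i [1..<Suc k]))"
    using i(3) by (auto simp: sorted_wrt_iff_nth_less simp del: upt_Suc)
  ultimately show "has_incr k (map w [1..<Suc n])"
    unfolding has_incr_def by (metis length_map length_upt diff_Suc_1)
next
  assume "has_incr k (map w [1..<Suc n])"
  then obtain ys where ys: "subseq ys (map w [1..<Suc n])" "length ys = k" "sorted_wrt (<) ys"
    unfolding has_incr_def by blast
  then obtain I where "ys = nths (map w [1..<Suc n]) I"
    by (auto simp: subseq_conv_nths simp del: upt_Suc)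
  then obtain zs where zs: "ys = map w zs" "zs = nths [1..<Suc n] I"
    by (simp add: nths_map del: upt_Suc)
  have ss: "sorted_wrt (<) zs"
    unfolding zs(2) strict_sorted_iff by (auto simp del: upt_Suc intro: sorted_nths)
  have sub: "set zs \<subseteq> {1..n}"
    using set_nths_subset[of "[1..<Suc n]" I] unfolding zs(2) by auto
  show "contains_pattern n w k id"
    unfolding contains_pattern_def
  proof (intro exI[of _ "\<lambda>j. zs ! (j - 1)"] conjI allI impI)
    show "strict_mono_on {1..k} (\<lambda>j. zs ! (j - 1))"
      using ss ys(2) zs(1) by (auto simp: strict_mono_on_def sorted_wrt_iff_nth_less)
    show "(\<lambda>j. zs ! (j - 1)) ` {1..k} \<subseteq> {1..n}"
      using sub ys(2) zs(1) by (force simp: subset_iff)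
    fix j l assume "1 \<le> j \<and> j < l \<and> l \<le> k"
    then show "w (zs ! (j - 1)) < w (zs ! (l - 1)) \<longleftrightarrow> id j < id l"
      using ys zs(1) by (auto simp: sorted_wrt_iff_nth_less)
  qed
qed

lemma card_Av:
  assumes "k \<ge> 1"
  shows "card (Av n k id) = tree_count k n ((\<lambda>_. 0)(0 := 1))"
proof -
  let ?l = "\<lambda>w. map w [1..<Suc n]"
  have set: "set [Suc 0..<Suc n] = {1..n}" "{Suc 0..<Suc n} = {1..n}"
    by auto
  have "bij_betw ?l (Av n k id) (ext k n [])"
    unfolding bij_betw_def
  proof (intro conjI equalityI subsetI inj_onI)
    fix w w' assume "w \<in> Av n k id" "w' \<in> Av n k id" and e: "?l w = ?l w'"
    then have p: "w permutes {1..n}" "w' permutes {1..n}"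
      by (auto simp: Av_def)
    show "w = w'"
    proof
      fix a
      show "w a = w' a"
        using e p[THEN permutes_not_in, of a] by (cases "a \<in> {1..n}") (auto simp: map_eq_conv simp del: upt_Suc)
    qed
  next
    fix ys assume "ys \<in> ?l ` Av n k id"
    then obtain w where w: "w permutes {1..n}" "\<not> contains_pattern n w k id" "ys = ?l w"
      by (auto simp: Av_def)
    have "set ys = {1..n}" "distinct ys"
      using permutes_image[OF w(1)] permutes_inj_on[OF w(1)] unfolding w(3)
      by (simp_all add: distinct_map set del: upt_Suc set_upt)
    then show "ys \<in> ext k n []"
      using w by (simp add: ext_def permutations_of_set_def contains_pattern_iff_incr del: upt_Suc)
  next
    fix ys assume "ys \<in> ext k n []"
    then have ys: "set ys = {1..n}" "distinct ys" "\<not> has_incr k ys"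
      by (auto simp: ext_def permutations_of_set_def)
    have len: "length ys = n"
      using ys by (metis card_atLeastAtMost diff_Suc_1 distinct_card)
    define w where "w a = (if a \<in> {1..n} then ys ! (a - 1) else a)" for a
    have l: "?l w = ys"
      using len by (intro nth_equalityI) (auto simp: w_def simp del: upt_Suc)
    have "inj_on w {1..n}"
      using ys(2) unfolding l[symmetric] by (simp add: distinct_map set del: upt_Suc)
    moreover have "w ` {1..n} = {1..n}"
      using ys(1) unfolding l[symmetric] by (simp add: set del: upt_Suc)
    ultimately have "w permutes {1..n}"
      by (intro bij_imp_permutes) (auto simp: bij_betw_def w_def)
    then have "w \<in> Av n k id"
      using ys(3) l by (simp add: Av_def contains_pattern_iff_incr del: upt_Suc)
    then show "ys \<in> ?l ` Av n k id"
      using l by blast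
  qed
  then have "card (Av n k id) = card (ext k n [])"
    by (rule bij_betw_same_card)
  also have "\<dots> = tree_count k n ((\<lambda>_. 0)(0 := 1))"
  proof -
    obtain k' where k: "k = Suc k'"
      using assms by (cases k) auto
    have s: "(\<Sum>i<j. ((\<lambda>_. 0)(0 := 1)) i) = (if j = 0 then 0 else (1::nat))" for j :: nat
      by (induction j) auto
    show ?thesis
      unfolding k by (rule card_ext) (auto simp: gaps_def s)
  qed
  finally show ?thesis .
qed

section \<open>Certified computations\<close>

text \<open>
  From configuration \<open>c\<close> all computation paths halt, all heads on all paths stay on the first \<open>s\<close>
  cells, and exactly \<open>m\<close> paths accept. Halting is expressed by the well-foundedness of the
  induction.
\<close>

inductive certified :: "ntm \<Rightarrow> bool list \<Rightarrow> nat \<Rightarrow> config \<Rightarrow> nat \<Rightarrow> bool" for M x s where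
  certifiedI: "\<lbrakk>\<And>T p. (T, p) \<in> set (work c) \<Longrightarrow> p < s;
    \<And>r. r \<in> enabled M x c \<Longrightarrow> certified M x s (apply_rule x c r) (f r);
    m = (if enabled M x c = {} then of_bool (control c \<in> accepting M)
         else \<Sum>r\<in>enabled M x c. f r)\<rbrakk> \<Longrightarrow> certified M x s c m"

lemma certified_halts:
  assumes "certified M x s c m"
  shows "\<exists>t. \<not> is_run M x c (map \<rho> [0..<t])"
  using assms
proof (induction arbitrary: \<rho>)
  case (certifiedI c f m)
  show ?case
  proof (cases "\<rho> 0 \<in> enabled M x c")
    case True
    then obtain t where t: "\<not> is_run M x (apply_rule x c (\<rho> 0)) (map (\<lambda>i. \<rho> (Suc i)) [0..<t])"
      using certifiedI by blast
    have "map \<rho> [0..<Suc t] = \<rho> 0 # map (\<lambda>i. \<rho> (Suc i)) [0..<t]"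
      by (simp only: upt_conv_Cons map_Suc_upt [symmetric] list.map map_map o_def zero_less_Suc)
    then have "\<not> is_run M x c (map \<rho> [0..<Suc t])"
      using t by (simp del: upt_Suc)
    then show ?thesis by blast
  next
    case False
    have "\<not> is_run M x c (map \<rho> [0..<Suc 0])"
      using False by simp
    then show ?thesis by blast
  qed
qed

lemma certified_space:
  assumes "certified M x s c m" "is_run M x c rs" "(T, p) \<in> set (work (foldl (apply_rule x) c rs))"
  shows "p < s"
  using assms
proof (induction arbitrary: rs)
  case (certifiedI c f m)
  then show ?case by (cases rs) auto
qed

text \<open>The set \<open>P c\<close> consists of the accepting paths that start from \<open>c\<close>.\<close>

lemma certified_card:
  assumes "certified M x s c m" "finite (rules M)"
  defines "P \<equiv> \<lambda>c. {rs. is_run M x c rs \<and> enabled M x (foldl (apply_rule x) c rs) = {} \<and>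
      control (foldl (apply_rule x) c rs) \<in> accepting M}"
  shows "finite (P c) \<and> card (P c) = m"
  using assms(1)
proof induction
  case (certifiedI c f m)
  have fin: "finite (enabled M x c)"
    using assms(2) by (simp add: enabled_def)
  show ?case
  proof (cases "enabled M x c = {}")
    case True
    then have "rs \<in> P c \<longleftrightarrow> rs = [] \<and> control c \<in> accepting M" for rs
      by (cases rs) (auto simp: P_def)
    then have "P c = (if control c \<in> accepting M then {[]} else {})"
      by auto
    then show ?thesis
      using certifiedI.hyps True by simp
  next
    case False
    then have "rs \<in> P c \<longleftrightarrow> rs \<in> (\<Union>r\<in>enabled M x c. (#) r ` P (apply_rule x c r))" for rs
      by (cases rs) (auto simp: P_def)
    then have P: "P c = (\<Union>r\<in>enabled M x c. (#) r ` P (apply_rule x c r))"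
      by blast
    have "card (P c) = (\<Sum>r\<in>enabled M x c. card ((#) r ` P (apply_rule x c r)))"
      unfolding P using fin certifiedI.IH by (intro card_UN_disjoint) auto
    also have "\<dots> = (\<Sum>r\<in>enabled M x c. f r)"
      using certifiedI.IH by (intro sum.cong refl) (simp add: card_image)
    finally show ?thesis
      using False certifiedI fin by (simp add: P)
  qed
qed

lemma sharpL_I:
  assumes "wf_ntm M" "(\<lambda>n. real (s n)) \<in> O(\<lambda>n. ln (real n))"
    "\<And>x. certified M x (s (length x)) (init_config M) (f x)"
  shows "f \<in> sharpL"
  unfolding sharpL_def
proof (intro CollectI exI[of _ M] conjI allI)
  show "halts_on_every_path M x" for x
    using certified_halts[OF assms(3)] by (auto simp: halts_on_every_path_def)
  show "log_space M"
    unfolding log_space_def space_bounded_def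
    using assms(2) certified_space[OF assms(3)] by blast
  show "f x = card (accepting_paths M x)" for x
    using certified_card[OF assms(3)] assms(1)
    by (simp add: accepting_paths_def wf_ntm_def Let_def)
qed (fact assms(1))

section \<open>Binary counters\<close>

text \<open>
  Counters are lists of binary digits, least significant first, possibly with leading zeros
  at the end of the list; decrementing keeps the number of digits.
\<close>

fun val :: "bool list \<Rightarrow> nat" where
  "val [] = 0"
| "val (b # ds) = of_bool b + 2 * val ds"

fun inc :: "bool list \<Rightarrow> bool list" where
  "inc [] = [True]"
| "inc (False # ds) = True # ds"
| "inc (True # ds) = False # inc ds"

fun dec :: "bool list \<Rightarrow> bool list" where
  "dec [] = []"
| "dec (False # ds) = True # dec ds"
| "dec (True # ds) = False # ds"

lemma val_inc [simp]: "val (inc ds) = Suc (val ds)"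
  by (induction ds rule: inc.induct) auto

lemma val_dec: "0 < val ds \<Longrightarrow> Suc (val (dec ds)) = val ds"
  by (induction ds rule: dec.induct) auto

lemma length_dec [simp]: "length (dec ds) = length ds"
  by (induction ds rule: dec.induct) auto

text \<open>
  A digit is added only if the new value is a power of two, so the length of a counter is
  logarithmic in the largest value it has taken.
\<close>

lemma length_inc: "2 ^ length (inc ds) \<le> max (2 ^ length ds) (2 * Suc (val ds))"
  by (induction ds rule: inc.induct) (auto simp: max_def split: if_splits)

text \<open>
  The tape contents for a counter: cell \<open>0\<close> stays blank so that the head can find the left end
  again, and cell \<open>j + 1\<close> holds digit number \<open>j\<close>. The digits zero and one are written as the
  symbols \<open>1\<close> and \<open>2\<close>, since \<open>0\<close> is the blank.
\<close>

definition cells :: "bool list \<Rightarrow> nat \<Rightarrow> nat" where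
  "cells ds j = (if j = 0 \<or> length ds < j then 0 else if ds ! (j - 1) then 2 else 1)"

lemma cells_0 [simp]: "cells ds 0 = 0"
  by (simp add: cells_def)

lemma cells_Nil: "cells [] = (\<lambda>_. 0)"
  by (auto simp: cells_def)

lemma cells_le [simp]: "cells ds j \<le> 2"
  by (simp add: cells_def)

lemma cells_end [simp]: "cells ds (Suc (length ds)) = 0"
  by (simp add: cells_def)

lemma cells_mid [simp]: "cells (us @ b # ds) (Suc (length us)) = (if b then 2 else 1)"
  by (auto simp: cells_def nth_append)

lemma cells_set_one [simp]:
  "(cells (us @ b # ds))(Suc (length us) := 2) = cells (us @ True # ds)"
  by (auto simp: cells_def nth_append fun_eq_iff nth_Cons')

lemma cells_set_zero [simp]:
  "(cells (us @ b # ds))(Suc (length us) := Suc 0) = cells (us @ False # ds)"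
  by (auto simp: cells_def nth_append fun_eq_iff nth_Cons')

lemma cells_extend [simp]: "(cells ds)(Suc (length ds) := 2) = cells (ds @ [True])"
  by (auto simp: cells_def nth_append fun_eq_iff)

section \<open>The machine\<close>

text \<open>
  All heads are on cell \<open>0\<close>, except that the head of tape \<open>i\<close> moves in the states \<open>Dec i\<close>,
  \<open>Inc i q\<close> (decrement or increment counter \<open>i\<close>, entered with that head on cell \<open>1\<close>) and
  \<open>Back i q\<close> (return that head to cell \<open>0\<close>); the argument \<open>q\<close> is the state to enter
  afterwards. In \<open>Ready\<close> the next input symbol is read. After a decrement, \<open>Transfer i\<close> starts
  the increment of counter \<open>i + 1\<close>, and \<open>Choose i\<close> then guesses whether to transfer another unit
  or to finish the insertion by incrementing counter \<open>i\<close>.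
\<close>

datatype state = Start | Ready | Accept | Dec nat | Transfer nat | Choose nat
  | Inc nat state | Back nat state

instance state :: countable
  by countable_datatype

text \<open>
  An instruction acts on a single work tape: the tape, the next state, the move of the
  input head, the symbol written and the move of the work head.
\<close>

type_synonym instr = "nat \<times> state \<times> move \<times> nat \<times> move"

text \<open>
  The instructions applicable in a state, given the input symbol and the list of symbols
  read on the work tapes. In \<open>Start\<close>, \<open>Ready\<close>, \<open>Transfer\<close> and \<open>Choose\<close> the head of the tape
  acted on is on cell \<open>0\<close>, so that writing \<open>0\<close> leaves this cell blank.
\<close>

fun instrs :: "nat \<Rightarrow> state \<Rightarrow> input_sym \<Rightarrow> nat list \<Rightarrow> instr set" where
  "instrs k Start a v = {(0, Inc 0 Ready, Stay, 0, MoveRight)}"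
| "instrs k Ready a v =
    (if a = Bit True then {(i, Dec i, MoveRight, 0, MoveRight) | i. Suc i < k}
     else if a = RightEnd then {(0, Accept, Stay, 0, Stay)} else {})"
| "instrs k Accept a v = {}"
| "instrs k (Dec i) a v =
    (if v ! i = 1 then {(i, Dec i, Stay, 2, MoveRight)}
     else if v ! i = 2 then {(i, Back i (Transfer i), Stay, 1, MoveLeft)} else {})"
| "instrs k (Transfer i) a v = {(Suc i, Inc (Suc i) (Choose i), Stay, 0, MoveRight)}"
| "instrs k (Choose i) a v = {(i, Dec i, Stay, 0, MoveRight), (i, Inc i Ready, Stay, 0, MoveRight)}"
| "instrs k (Inc i q) a v =
    (if v ! i = 2 then {(i, Inc i q, Stay, 1, MoveRight)}
     else {(i, Back i q, Stay, 2, MoveLeft)})"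
| "instrs k (Back i q) a v =
    (if v ! i = 0 then {(i, q, Stay, 0, Stay)} else {(i, Back i q, Stay, v ! i, MoveLeft)})"

text \<open>The possible arguments \<open>q\<close> of \<open>Inc i q\<close> and \<open>Back i q\<close>.\<close>

definition conts :: "nat \<Rightarrow> state set" where
  "conts k = insert Ready (Choose ` {..<k} \<union> Transfer ` {i. Suc i < k})"

text \<open>
  The type of states is infinite; these finitely many contain all the states that are reachable.
\<close>

definition states :: "nat \<Rightarrow> state set" where
  "states k = {Start, Accept} \<union> conts k \<union> Dec ` {i. Suc i < k} \<union>
     (\<lambda>(i, q). Inc i q) ` ({..<k} \<times> conts k) \<union> (\<lambda>(i, q). Back i q) ` ({..<k} \<times> conts k)"

text \<open>
  The rule for an instruction. On the other tapes it writes back the symbol read and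
  does not move.
\<close>

definition mk_rule :: "state \<Rightarrow> input_sym \<Rightarrow> nat list \<Rightarrow> instr \<Rightarrow> rule" where
  "mk_rule q a v = (\<lambda>(i, q', im, b, d). \<lparr>source = to_nat q, input_read = a, work_read = v,
     target = to_nat q', input_move = im, work_action = (map (\<lambda>c. (c, Stay)) v)[i := (b, d)]\<rparr>)"

lemma mk_rule_simps [simp]:
  "source (mk_rule q a v act) = to_nat q"
  "input_read (mk_rule q a v act) = a"
  "work_read (mk_rule q a v act) = v"
  by (simp_all add: mk_rule_def split: prod.split)

definition machine :: "nat \<Rightarrow> ntm" where
  "machine k = \<lparr>num_tapes = k, start = to_nat Start, accepting = {to_nat Accept},
     rules = (\<Union>q\<in>states k. \<Union>a. \<Union>v\<in>{v. set v \<subseteq> {..2} \<and> length v = k}.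
       mk_rule q a v ` instrs k q a v)\<rparr>"

lemma finite_instrs: "finite (instrs k q a v)"
proof -
  have "{(i, Dec i, MoveRight, 0, MoveRight) | i. Suc i < k} \<subseteq> (\<lambda>i. (i, Dec i, MoveRight, 0, MoveRight)) ` {..<k}"
    by auto
  then have "finite {(i, Dec i, MoveRight, 0 :: nat, MoveRight) | i. Suc i < k}"
    by (rule finite_subset) simp
  then show ?thesis
    by (cases q) auto
qed

lemma UNIV_input_sym: "UNIV = {LeftEnd, RightEnd, Bit True, Bit False}"
proof -
  have "a \<in> {LeftEnd, RightEnd, Bit True, Bit False}" for a
    by (cases a) auto
  then show ?thesis by blast
qed

lemma wf_machine: "wf_ntm (machine k)"
proof -
  have c: "finite {i. Suc i < k}"
    by (rule finite_subset[of _ "{..<k}"]) auto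
  then have "finite (conts k)"
    by (simp add: conts_def)
  with c have "finite (states k)"
    by (simp add: states_def)
  moreover have "finite {v :: nat list. set v \<subseteq> {..2} \<and> length v = k}"
    by (rule finite_lists_length_eq) simp
  moreover have "finite (UNIV :: input_sym set)"
    by (simp add: UNIV_input_sym)
  ultimately have "finite (rules (machine k))"
    by (simp add: machine_def finite_instrs)
  then show ?thesis
    by (auto simp: wf_ntm_def machine_def mk_rule_def split: prod.splits)
qed

type_synonym tape = "(nat \<Rightarrow> nat) \<times> nat"

text \<open>Configurations with states in place of their numbers.\<close>

definition conf :: "state \<Rightarrow> nat \<Rightarrow> tape list \<Rightarrow> config" where
  "conf q pos W = \<lparr>control = to_nat q, input_pos = pos, work = W\<rparr>"

text \<open>The configuration after an instruction, on an input of length \<open>n\<close>.\<close>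

fun perform :: "nat \<Rightarrow> nat \<Rightarrow> tape list \<Rightarrow> instr \<Rightarrow> config" where
  "perform n pos W (i, q, im, b, d) = conf q (min (n + 1) (shift im pos))
     (W[i := ((fst (W ! i))(snd (W ! i) := b), shift d (snd (W ! i)))])"

abbreviation reads :: "tape list \<Rightarrow> nat list" where
  "reads W \<equiv> map (\<lambda>(T, p). T p) W"

text \<open>Tapes that the rules of the machine apply to, with the heads within space \<open>s\<close>.\<close>

definition fits :: "nat \<Rightarrow> nat \<Rightarrow> tape list \<Rightarrow> bool" where
  "fits k s W \<longleftrightarrow> length W = k \<and> (\<forall>(T, p) \<in> set W. p < s \<and> T p \<le> 2)"

lemma apply_mk_rule:
  assumes "fst act < length W"
  shows "apply_rule x (conf q pos W) (mk_rule q a (reads W) act) = perform (length x) pos W act"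
proof -
  obtain i q' im b d where act: "act = (i, q', im, b, d)" by (cases act)
  have "map2 (\<lambda>(T, p) (a, d). (T(p := a), shift d p)) W ((map (\<lambda>c. (c, Stay)) (reads W))[i := (b, d)]) =
     W[i := ((fst (W ! i))(snd (W ! i) := b), shift d (snd (W ! i)))]"
    using assms by (intro nth_equalityI) (auto simp: nth_list_update act split: prod.splits)
  then show ?thesis
    by (simp add: act mk_rule_def apply_rule_def conf_def)
qed

lemma enabled_machine:
  assumes "q \<in> states k" "fits k s W"
  shows "enabled (machine k) x (conf q pos W) =
    mk_rule q (input_sym_at x pos) (reads W) ` instrs k q (input_sym_at x pos) (reads W)"
proof -
  have "set (reads W) \<subseteq> {..2}" "length (reads W) = k"
    using assms(2) by (auto simp: fits_def)
  then have "mk_rule q (input_sym_at x pos) (reads W) act \<in> rules (machine k)"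
    if "act \<in> instrs k q (input_sym_at x pos) (reads W)" for act
    using that assms(1) unfolding machine_def ntm.simps by blast
  moreover have "r \<in> mk_rule q (input_sym_at x pos) (reads W) ` instrs k q (input_sym_at x pos) (reads W)"
    if r_en: "r \<in> enabled (machine k) x (conf q pos W)" for r
  proof -
    obtain q' a v act where r: "r = mk_rule q' a v act" "act \<in> instrs k q' a v"
      using r_en unfolding enabled_def machine_def by auto
    then have "q' = q" "a = input_sym_at x pos" "v = reads W"
      using that by (simp_all add: enabled_def conf_def)
    then show ?thesis using r by simp
  qed
  ultimately show ?thesis
    by (auto simp: enabled_def conf_def)
qed

text \<open>
  Instructions with different target states give different rules, so the accepting paths are
  counted by a sum over instructions rather than over rules.
\<close>

lemma certified_step:
  assumes q: "q \<in> states k" and W: "fits k s W"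
    and A: "A = instrs k q (input_sym_at x pos) (reads W)"
    and inj: "inj_on (\<lambda>act. fst (snd act)) A"
    and steps: "\<And>act. act \<in> A \<Longrightarrow>
      fst act < k \<and> certified (machine k) x s (perform (length x) pos W act) (f act)"
    and m: "m = (if A = {} then of_bool (q = Accept) else \<Sum>act\<in>A. f act)"
  shows "certified (machine k) x s (conf q pos W) m"
proof -
  let ?mk = "mk_rule q (input_sym_at x pos) (reads W)"
  have en: "enabled (machine k) x (conf q pos W) = ?mk ` A"
    using enabled_machine[OF q W] A by simp
  have "fst (snd act) = fst (snd act')" if "?mk act = ?mk act'" for act act'
    using that by (auto simp: mk_rule_def split: prod.splits)
  then have inj': "inj_on ?mk A"
    using inj unfolding inj_on_def by blast
  show ?thesis
  proof (rule certifiedI[where f = "\<lambda>r. f (inv_into A ?mk r)"])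
    show "p < s" if "(T, p) \<in> set (work (conf q pos W))" for T p
      using that W by (auto simp: fits_def conf_def)
    show "certified (machine k) x s (apply_rule x (conf q pos W) r) (f (inv_into A ?mk r))"
      if "r \<in> enabled (machine k) x (conf q pos W)" for r
    proof -
      from that obtain act where act: "act \<in> A" "r = ?mk act"
        using en by auto
      moreover have "fst act < length W"
        using steps[OF act(1)] W by (simp add: fits_def)
      ultimately show ?thesis
        using steps[OF act(1)] inj' by (simp add: apply_mk_rule)
    qed
    show "m = (if enabled (machine k) x (conf q pos W) = {}
       then of_bool (control (conf q pos W) \<in> accepting (machine k))
       else \<Sum>r\<in>enabled (machine k) x (conf q pos W). f (inv_into A ?mk r))"
      unfolding en m using inj' by (simp add: sum.reindex conf_def machine_def)
  qed
qed

lemma certified_step1: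
  assumes "q \<in> states k" "fits k s W" "i < k" "pos \<le> length x + 1"
    "instrs k q (input_sym_at x pos) (reads W) = {(i, q', Stay, b, d)}"
    "certified (machine k) x s
      (conf q' pos (W[i := ((fst (W ! i))(snd (W ! i) := b), shift d (snd (W ! i)))])) m"
  shows "certified (machine k) x s (conf q pos W) m"
  by (rule certified_step[OF assms(1,2) refl, where f = "\<lambda>_. m"]) (use assms in \<open>auto simp: min_def\<close>)

text \<open>The work tapes holding the given counters, with all heads on cell \<open>0\<close>.\<close>

definition rewound :: "bool list list \<Rightarrow> tape list" where
  "rewound dss = map (\<lambda>ds. (cells ds, 0)) dss"

lemma length_rewound [simp]: "length (rewound dss) = length dss"
  by (simp add: rewound_def)

lemma rewound_update: "(rewound dss)[i := (cells ds, 0)] = rewound (dss[i := ds])"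
  by (simp add: rewound_def map_update)

lemma fits_rewound:
  assumes "length dss = k" "p < s"
  shows "fits k s ((rewound dss)[i := (cells ds, p)])"
  using assms by (auto simp: fits_def rewound_def dest!: set_update_subset_insert[THEN subsetD])

section \<open>Subroutines of the machine\<close>

lemma certified_Back:
  assumes "length dss = k" "i < k" "q \<in> conts k" "pos \<le> length x + 1" "p \<le> length ds" "p < s"
    "certified (machine k) x s (conf q pos ((rewound dss)[i := (cells ds, 0)])) m"
  shows "certified (machine k) x s (conf (Back i q) pos ((rewound dss)[i := (cells ds, p)])) m"
  using assms(5,6)
proof (induction p)
  case 0
  show ?case
  proof (rule certified_step1[where q' = q and i = i and b = 0 and d = Stay])
  qed (use assms 0 in \<open>auto simp: states_def fits_rewound fun_upd_idem\<close>)
next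
  case (Suc p)
  have IH: "certified (machine k) x s (conf (Back i q) pos ((rewound dss)[i := (cells ds, p)])) m"
    using Suc by simp
  have "cells ds (Suc p) \<noteq> 0"
    using Suc.prems by (simp add: cells_def)
  show ?case
  proof (rule certified_step1[where q' = "Back i q" and i = i and b = "cells ds (Suc p)" and d = MoveLeft])
  qed (use assms(1-4) Suc.prems IH \<open>cells ds (Suc p) \<noteq> 0\<close> in \<open>auto simp: states_def fits_rewound\<close>)
qed

text \<open>The digits \<open>us\<close> are those the head has already passed while carrying.\<close>

lemma certified_Inc_aux:
  assumes "length dss = k" "i < k" "q \<in> conts k" "pos \<le> length x + 1" "Suc (length us + length ds) < s"
    "certified (machine k) x s (conf q pos ((rewound dss)[i := (cells (us @ inc ds), 0)])) m"
  shows "certified (machine k) x s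
    (conf (Inc i q) pos ((rewound dss)[i := (cells (us @ ds), Suc (length us))])) m"
  using assms(5,6)
proof (induction ds arbitrary: us rule: inc.induct)
  case 1
  have rewind: "certified (machine k) x s
    (conf (Back i q) pos ((rewound dss)[i := (cells (us @ [True]), length us)])) m"
    by (rule certified_Back) (use assms(1-4) 1 in auto)
  show ?case
    by (rule certified_step1[where q' = "Back i q" and i = i and b = 2 and d = MoveLeft])
      (use assms(1-4) 1 rewind in \<open>auto simp: states_def fits_rewound\<close>)
next
  case (2 ds)
  have rewind: "certified (machine k) x s
    (conf (Back i q) pos ((rewound dss)[i := (cells (us @ True # ds), length us)])) m"
    by (rule certified_Back) (use assms(1-4) 2 in auto)
  show ?case
    by (rule certified_step1[where q' = "Back i q" and i = i and b = 2 and d = MoveLeft])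
      (use assms(1-4) 2 rewind in \<open>auto simp: states_def fits_rewound\<close>)
next
  case (3 ds)
  have carry: "certified (machine k) x s
    (conf (Inc i q) pos ((rewound dss)[i := (cells (us @ False # ds), Suc (Suc (length us)))])) m"
    using "3.IH"[of "us @ [False]"] "3.prems" by simp
  show ?case
    by (rule certified_step1[where q' = "Inc i q" and i = i and b = 1 and d = MoveRight])
      (use assms(1-4) 3(2) carry in \<open>auto simp: states_def fits_rewound\<close>)
qed

lemma certified_Inc:
  assumes "length dss = k" "i < k" "q \<in> conts k" "pos \<le> length x + 1" "Suc (length (dss ! i)) < s"
    "certified (machine k) x s (conf q pos (rewound (dss[i := inc (dss ! i)]))) m"
  shows "certified (machine k) x s
    (conf (Inc i q) pos ((rewound dss)[i := (cells (dss ! i), 1)])) m"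
  using certified_Inc_aux[of dss k i q pos x "[]" "dss ! i" s m] assms
  by (simp add: rewound_update)

text \<open>
  Again \<open>us\<close> are the digits already passed. From value zero the head runs into
  the blank after the last digit, where no rule applies, and no path accepts.
\<close>

lemma certified_Dec_aux:
  assumes "length dss = k" "Suc i < k" "pos \<le> length x + 1" "Suc (length us + length ds) < s"
    "if val ds = 0 then m = 0 else
      certified (machine k) x s (conf (Transfer i) pos ((rewound dss)[i := (cells (us @ dec ds), 0)])) m"
  shows "certified (machine k) x s
    (conf (Dec i) pos ((rewound dss)[i := (cells (us @ ds), Suc (length us))])) m"
  using assms(4,5)
proof (induction ds arbitrary: us rule: dec.induct)
  case 1
  show ?case
    by (rule certified_step[OF _ _ refl, where f = "\<lambda>_. 0"])
      (use assms(1-3) 1 in \<open>auto simp: states_def fits_rewound\<close>)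
next
  case (2 ds)
  have borrow: "certified (machine k) x s
    (conf (Dec i) pos ((rewound dss)[i := (cells (us @ True # ds), Suc (Suc (length us)))])) m"
    using "2.IH"[of "us @ [True]"] "2.prems" by (simp split: if_splits)
  show ?case
    by (rule certified_step1[where q' = "Dec i" and i = i and b = 2 and d = MoveRight])
      (use assms(1-3) 2(2) borrow in \<open>auto simp: states_def fits_rewound\<close>)
next
  case (3 ds)
  have rewind: "certified (machine k) x s
    (conf (Back i (Transfer i)) pos ((rewound dss)[i := (cells (us @ False # ds), length us)])) m"
    by (rule certified_Back) (use assms(1-3) 3 in \<open>auto simp: conts_def\<close>)
  show ?case
    by (rule certified_step1[where q' = "Back i (Transfer i)" and i = i and b = 1 and d = MoveLeft])
      (use assms(1-3) 3 rewind in \<open>auto simp: states_def conts_def fits_rewound\<close>)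
qed

lemma certified_Dec:
  assumes "length dss = k" "Suc i < k" "pos \<le> length x + 1" "Suc (length (dss ! i)) < s"
    "if val (dss ! i) = 0 then m = 0 else
      certified (machine k) x s (conf (Transfer i) pos (rewound (dss[i := dec (dss ! i)]))) m"
  shows "certified (machine k) x s
    (conf (Dec i) pos ((rewound dss)[i := (cells (dss ! i), 1)])) m"
  using certified_Dec_aux[of dss k i pos x "[]" "dss ! i" s m] assms
  by (simp add: rewound_update)

section \<open>Counting the accepting paths\<close>

text \<open>
  Room for the blank cell \<open>0\<close>, as many digits as \<open>n + 1\<close> has, and the blank after the last digit.
\<close>

definition space :: "nat \<Rightarrow> nat" where
  "space n = nat \<lfloor>log 2 (2 * (real n + 1))\<rfloor> + 2"

lemma length_less_space:
  assumes "2 ^ length ds \<le> 2 * (n + 1)"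
  shows "Suc (length ds) < space n"
proof -
  have "real (2 ^ length ds) \<le> real (2 * (n + 1))"
    using assms by (rule of_nat_mono)
  then have "2 powr real (length ds) \<le> 2 * (real n + 1)"
    by (simp add: powr_realpow)
  then have "real (length ds) \<le> log 2 (2 * (real n + 1))"
    by (subst le_log_iff) auto
  then have "int (length ds) \<le> \<lfloor>log 2 (2 * (real n + 1))\<rfloor>"
    by (simp add: le_floor_iff)
  then show ?thesis
    by (simp add: space_def)
qed

lemma space_bigo: "(\<lambda>n. real (space n)) \<in> O(\<lambda>n. ln (real n))"
proof -
  have "(\<lambda>n. real (space n)) \<in> O(\<lambda>n. log 2 (2 * (real n + 1)) + 2)"
  proof (rule bigoI[where c = 1], rule always_eventually, rule allI)
    fix n
    have "0 \<le> log 2 (2 * (real n + 1))"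
      by (subst zero_le_log_cancel_iff) auto
    then show "norm (real (space n)) \<le> 1 * norm (log 2 (2 * (real n + 1)) + 2)"
      by (simp add: space_def)
  qed
  also have "(\<lambda>n. log 2 (2 * (real n + 1)) + 2) \<in> O(\<lambda>n. ln (real n))"
    by real_asymp
  finally show ?thesis .
qed

text \<open>
  The counters have the values \<open>d i\<close>, and at most as many digits as \<open>n + 1\<close>.
\<close>

definition stores :: "nat \<Rightarrow> nat \<Rightarrow> bool list list \<Rightarrow> (nat \<Rightarrow> nat) \<Rightarrow> bool" where
  "stores k n dss d \<longleftrightarrow> length dss = k \<and>
    (\<forall>i<k. val (dss ! i) = d i \<and> 2 ^ length (dss ! i) \<le> 2 * (n + 1))"

lemma stores_inc:
  assumes "stores k n dss d" "d i \<le> n"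
  shows "stores k n (dss[i := inc (dss ! i)]) (d(i := Suc (d i)))"
  using assms length_inc[of "dss ! i"] by (auto simp: stores_def nth_list_update)

lemma stores_dec:
  assumes "stores k n dss d" "0 < d i" "i < k"
  shows "stores k n (dss[i := dec (dss ! i)]) (d(i := d i - 1))"
  using assms val_dec[of "dss ! i"] by (auto simp: stores_def nth_list_update)

lemma perform_rewound:
  assumes "length dss = k" "i < k"
  shows "perform n pos (rewound dss) (i, q, im, 0, MoveRight) =
    conf q (min (n + 1) (shift im pos)) ((rewound dss)[i := (cells (dss ! i), 1)])"
  using assms by (simp add: rewound_def fun_upd_idem)

lemma fits_rewound': "length dss = k \<Longrightarrow> 0 < s \<Longrightarrow> fits k s (rewound dss)"
  by (auto simp: fits_def rewound_def)

lemma space_pos: "0 < space n"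
  by (simp add: space_def)

lemma sum_ge_pair:
  fixes d :: "nat \<Rightarrow> nat"
  assumes "Suc i < k"
  shows "d i + d (Suc i) \<le> (\<Sum>l<k. d l)"
proof -
  have "d i + d (Suc i) = (\<Sum>l\<in>{i, Suc i}. d l)" by simp
  also have "\<dots> \<le> (\<Sum>l<k. d l)"
    using assms by (intro sum_mono2) auto
  finally show ?thesis .
qed

text \<open>
  The loop between \<open>Dec i\<close> and \<open>Choose i\<close>, followed by the increment of counter \<open>i\<close>, transfers
  each possible number \<open>t\<close> of units on exactly one path. Here \<open>F d'\<close> is the number of accepting
  paths that continue from \<open>Ready\<close> with the counter values \<open>d'\<close>.
\<close>

lemma certified_loop:
  assumes "stores k n dss d" "Suc i < k" "(\<Sum>l<k. d l) \<le> n" "length x = n" "pos \<le> n + 1"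
    and ready: "\<And>dss' d'. stores k n dss' d' \<Longrightarrow> (\<Sum>l<k. d' l) = Suc (\<Sum>l<k. d l) \<Longrightarrow>
      certified (machine k) x (space n) (conf Ready pos (rewound dss')) (F d')"
  shows "certified (machine k) x (space n) (conf (Dec i) pos ((rewound dss)[i := (cells (dss ! i), 1)]))
    (\<Sum>t\<in>{1..d i}. F (d(i := d i - t + 1, Suc i := d (Suc i) + t)))"
  using assms(1,3) ready
proof (induction "d i" arbitrary: dss d)
  case 0
  show ?case
  proof (rule certified_Dec)
    show "Suc (length (dss ! i)) < space n"
      using 0(2) assms(2) by (intro length_less_space) (auto simp: stores_def)
  qed (use 0(1,2) assms(2,4,5) in \<open>auto simp: stores_def\<close>)
next
  case (Suc D)
  let ?dss1 = "dss[i := dec (dss ! i)]" and ?d1 = "d(i := D)"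
  have st1: "stores k n ?dss1 ?d1"
  proof -
    have "D = d i - 1" "0 < d i" "i < k"
      using Suc.hyps(2) assms(2) by auto
    then show ?thesis
      using stores_dec[OF Suc.prems(1), of i] by simp
  qed
  let ?dss2 = "?dss1[Suc i := inc (?dss1 ! Suc i)]" and ?d2 = "d(i := D, Suc i := Suc (d (Suc i)))"
  have pair: "d i + d (Suc i) \<le> n"
    using sum_ge_pair[OF assms(2), of d] Suc.prems(2) by simp
  have st2: "stores k n ?dss2 ?d2"
    using stores_inc[OF st1, of "Suc i"] pair by simp
  let ?dss3 = "?dss2[i := inc (?dss2 ! i)]" and ?d3 = "d(Suc i := Suc (d (Suc i)))"
  have st3: "stores k n ?dss3 ?d3"
    using stores_inc[OF st2, of i] pair Suc.hyps(2) by (simp add: fun_upd_twist)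
  have sum3: "(\<Sum>l<k. ?d3 l) = Suc (\<Sum>l<k. d l)"
  proof -
    have "Suc i \<in> {..<k}" using assms(2) by simp
    then show ?thesis by (simp add: sum.remove[of "{..<k}" "Suc i"])
  qed
  have sum2: "(\<Sum>l<k. ?d2 l) = (\<Sum>l<k. d l)"
  proof -
    have "Suc i \<in> {..<k}" "i \<in> {..<k} - {Suc i}" using assms(2) by auto
    then show ?thesis
      using Suc.hyps(2) by (simp add: sum.remove[of "{..<k}" "Suc i"] sum.remove[of "{..<k} - {Suc i}" i])
  qed
  note len = Suc.prems(1)[unfolded stores_def] st1[unfolded stores_def] st2[unfolded stores_def]
  let ?G = "\<lambda>t. F (d(i := d i - t + 1, Suc i := d (Suc i) + t))"
  \<comment> \<open>Continuing after the first unit transfers \<open>t + 1\<close> units in all, finishing transfers one.\<close>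
  have dec: "certified (machine k) x (space n) (conf (Dec i) pos ((rewound ?dss2)[i := (cells (?dss2 ! i), 1)]))
    (\<Sum>t\<in>{1..D}. ?G (Suc t))"
  proof -
    have "certified (machine k) x (space n) (conf (Dec i) pos ((rewound ?dss2)[i := (cells (?dss2 ! i), 1)]))
      (\<Sum>t\<in>{1..?d2 i}. F (?d2(i := ?d2 i - t + 1, Suc i := ?d2 (Suc i) + t)))"
      using Suc.hyps(1)[of ?d2 ?dss2] st2 sum2 Suc.prems by simp
    moreover have "F (?d2(i := ?d2 i - t + 1, Suc i := ?d2 (Suc i) + t)) = ?G (Suc t)" for t
      using Suc.hyps(2) by (intro arg_cong[of _ _ F]) (auto simp: fun_eq_iff)
    ultimately show ?thesis by simp
  qed
  have inc: "certified (machine k) x (space n) (conf (Inc i Ready) pos ((rewound ?dss2)[i := (cells (?dss2 ! i), 1)]))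
    (?G 1)"
  proof (rule certified_Inc)
    have d3: "d(i := d i - 1 + 1, Suc i := d (Suc i) + 1) = ?d3"
      using Suc.hyps(2) by auto
    show "certified (machine k) x (space n) (conf Ready pos (rewound ?dss3)) (?G 1)"
      unfolding d3 by (rule Suc.prems(3)[OF st3 sum3])
    show "Suc (length (?dss2 ! i)) < space n"
      using len assms(2) by (intro length_less_space) auto
  qed (use len assms in \<open>auto simp: conts_def\<close>)
  have "(\<Sum>t\<in>{1..d i}. ?G t) = ?G 1 + (\<Sum>t\<in>{1..D}. ?G (Suc t))"
    using sum.atLeast_Suc_atMost[of 1 "d i" ?G] sum.shift_bounds_cl_Suc_ivl[of ?G 1 D] Suc.hyps(2) by simp
  then have total: "?G 1 + (\<Sum>t\<in>{1..D}. ?G (Suc t)) = (\<Sum>t\<in>{1..d i}. ?G t)"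
    by simp
  have choose: "certified (machine k) x (space n) (conf (Choose i) pos (rewound ?dss2)) (\<Sum>t\<in>{1..d i}. ?G t)"
    unfolding total[symmetric]
  proof (rule certified_step[OF _ _ refl,
        where f = "\<lambda>act. if fst (snd act) = Dec i then \<Sum>t\<in>{1..D}. ?G (Suc t) else ?G 1"])
    show "Choose i \<in> states k"
      using assms(2) by (auto simp: states_def conts_def)
    show "fits k (space n) (rewound ?dss2)"
      using len by (intro fits_rewound') (auto simp: space_pos)
    show "fst act < k \<and> certified (machine k) x (space n) (perform (length x) pos (rewound ?dss2) act)
        (if fst (snd act) = Dec i then \<Sum>t\<in>{1..D}. ?G (Suc t) else ?G 1)"
      if "act \<in> instrs k (Choose i) (input_sym_at x pos) (reads (rewound ?dss2))" for act
    proof -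
      have "act = (i, Dec i, Stay, 0, MoveRight) \<or> act = (i, Inc i Ready, Stay, 0, MoveRight)"
        using that by simp
      moreover have "perform (length x) pos (rewound ?dss2) (i, q, Stay, 0, MoveRight) =
        conf q pos ((rewound ?dss2)[i := (cells (?dss2 ! i), 1)])" for q
        using len assms(2,4,5) by (subst perform_rewound) (auto simp: min_def)
      ultimately show ?thesis
        using dec inc assms(2) by (elim disjE) (simp_all del: perform.simps One_nat_def)
    qed
  qed simp_all
  \<comment> \<open>The rest follows the machine backwards, to the decrement that the loop starts with.\<close>
  have inc': "certified (machine k) x (space n) (conf (Inc (Suc i) (Choose i)) pos
      ((rewound ?dss1)[Suc i := (cells (?dss1 ! Suc i), 1)])) (\<Sum>t\<in>{1..d i}. ?G t)"
  proof (rule certified_Inc)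
    show "Suc (length (?dss1 ! Suc i)) < space n"
      using len assms(2) by (intro length_less_space) auto
    show "Choose i \<in> conts k"
      using assms(2) by (auto simp: conts_def)
  qed (use len assms choose in auto)
  have transfer: "certified (machine k) x (space n) (conf (Transfer i) pos (rewound ?dss1)) (\<Sum>t\<in>{1..d i}. ?G t)"
  proof (rule certified_step1[where i = "Suc i" and d = MoveRight and b = 0])
    show "Transfer i \<in> states k"
      using assms(2) by (auto simp: states_def conts_def)
    show "fits k (space n) (rewound ?dss1)"
      using len by (intro fits_rewound') (auto simp: space_pos)
    have "(rewound ?dss1 ! Suc i) = (cells (?dss1 ! Suc i), 0)"
      using len assms(2) by (simp add: rewound_def)
    then show "certified (machine k) x (space n) (conf (Inc (Suc i) (Choose i)) pos
        ((rewound ?dss1)[Suc i := ((fst (rewound ?dss1 ! Suc i))(snd (rewound ?dss1 ! Suc i) := 0),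
           shift MoveRight (snd (rewound ?dss1 ! Suc i)))])) (\<Sum>t\<in>{1..d i}. ?G t)"
      using inc' by (simp add: fun_upd_idem)
  qed (use assms(2,4,5) in auto)
  show ?case
  proof (rule certified_Dec)
    show "Suc (length (dss ! i)) < space n"
      using len assms(2) by (intro length_less_space) auto
    show "if val (dss ! i) = 0 then (\<Sum>t\<in>{1..d i}. ?G t) = 0 else certified (machine k) x (space n)
        (conf (Transfer i) pos (rewound ?dss1)) (\<Sum>t\<in>{1..d i}. ?G t)"
      using transfer len assms(2) Suc.hyps(2) by auto
  qed (use len assms in auto)
qed

text \<open>With the input head on cell \<open>p + 1\<close>, the input symbols from \<open>x ! p\<close> on are still unread.\<close>

lemma certified_Ready:
  assumes "stores k n dss d" "(\<Sum>l<k. d l) = Suc p" "length x = n" "p + r = n"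
  shows "certified (machine k) x (space n) (conf Ready (Suc p) (rewound dss))
    (if \<forall>j\<in>{p..<n}. x ! j then tree_count k r d else 0)"
  using assms
proof (induction r arbitrary: dss d p)
  case 0
  have k: "0 < k" using 0 by (cases k) auto
  have acc: "certified (machine k) x (space n) (conf Accept (Suc p) (rewound dss)) 1"
    by (rule certified_step[OF _ _ refl, where f = "\<lambda>_. 0"])
      (use 0 in \<open>auto simp: states_def fits_rewound' space_pos stores_def\<close>)
  have "(rewound dss ! 0) = (cells (dss ! 0), 0)"
    using 0 k by (simp add: rewound_def stores_def)
  then have W: "(rewound dss)[0 := ((fst (rewound dss ! 0))(snd (rewound dss ! 0) := 0),
      shift Stay (snd (rewound dss ! 0)))] = rewound dss"
    using list_update_id[of "rewound dss" 0] by (simp add: fun_upd_idem)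
  have "certified (machine k) x (space n) (conf Ready (Suc p) (rewound dss)) 1"
  proof (rule certified_step1[where q' = Accept and i = 0 and b = 0 and d = Stay])
  qed (use 0 k W acc in \<open>auto simp: states_def conts_def fits_rewound' space_pos stores_def input_sym_at_def\<close>)
  then show ?case
    using 0 by simp
next
  case (Suc r)
  define B where "B \<longleftrightarrow> (\<forall>j\<in>{Suc p..<n}. x ! j)"
  define F where "F d' = (if B then tree_count k r d' else 0)" for d'
  have pn: "p < n" using Suc.prems by simp
  have sym: "input_sym_at x (Suc p) = Bit (x ! p)"
    using Suc.prems by (simp add: input_sym_at_def)
  have split: "(\<forall>j\<in>{p..<n}. x ! j) \<longleftrightarrow> x ! p \<and> B"
  proof -
    have "{p..<n} = insert p {Suc p..<n}" using pn by auto
    then show ?thesis by (simp add: B_def)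
  qed
  have len: "length dss = k" using Suc.prems by (simp add: stores_def)
  show ?case
  proof (cases "x ! p")
    case False
    then have not_all: "\<not> (\<forall>j\<in>{p..<n}. x ! j)"
      using split by blast
    show ?thesis
      unfolding if_not_P[OF not_all]
      by (rule certified_step[OF _ _ refl, where f = "\<lambda>_. 0"])
        (use False len sym in \<open>auto simp: states_def conts_def fits_rewound' space_pos\<close>)
  next
    case True
    let ?S = "\<lambda>i. \<Sum>t\<in>{1..d i}. F (d(i := d i - t + 1, Suc i := d (Suc i) + t))"
    have loop: "certified (machine k) x (space n)
        (conf (Dec i) (Suc (Suc p)) ((rewound dss)[i := (cells (dss ! i), 1)])) (?S i)"
      if "Suc i < k" for i
    proof (rule certified_loop)
      fix dss' d' assume "stores k n dss' d'" "(\<Sum>l<k. d' l) = Suc (\<Sum>l<k. d l)"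
      then show "certified (machine k) x (space n) (conf Ready (Suc (Suc p)) (rewound dss')) (F d')"
        using Suc.IH[of dss' d' "Suc p"] Suc.prems by (simp add: F_def B_def)
    qed (use that Suc.prems in auto)
    let ?A = "{(i, Dec i, MoveRight, 0 :: nat, MoveRight) | i. Suc i < k}"
    have A: "?A = (\<lambda>i. (i, Dec i, MoveRight, 0, MoveRight)) ` {i. Suc i < k}"
      by auto
    have "(\<Sum>act\<in>?A. ?S (fst act)) = (\<Sum>i\<in>{i. Suc i < k}. ?S i)"
      unfolding A by (subst sum.reindex) (auto simp: inj_on_def)
    also have "\<dots> = (if \<forall>j\<in>{p..<n}. x ! j then tree_count k (Suc r) d else 0)"
      unfolding split by (cases B) (simp_all add: F_def True)
    finally have S: "(\<Sum>act\<in>?A. ?S (fst act)) = (if \<forall>j\<in>{p..<n}. x ! j then tree_count k (Suc r) d else 0)" .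
    show ?thesis
    proof (rule certified_step[where A = ?A and f = "\<lambda>act. ?S (fst act)"])
      show "?A = instrs k Ready (input_sym_at x (Suc p)) (reads (rewound dss))"
        using True sym by simp
      show "fst act < k \<and> certified (machine k) x (space n)
          (perform (length x) (Suc p) (rewound dss) act) (?S (fst act))" if act: "act \<in> ?A" for act
      proof -
        obtain i where i: "act = (i, Dec i, MoveRight, 0, MoveRight)" "Suc i < k"
          using act by blast
        have "min (length x + 1) (shift MoveRight (Suc p)) = Suc (Suc p)"
          using pn Suc.prems(3) by simp
        then have "perform (length x) (Suc p) (rewound dss) act =
            conf (Dec i) (Suc (Suc p)) ((rewound dss)[i := (cells (dss ! i), 1)])"
          using len i perform_rewound[of dss k i "length x" "Suc p" "Dec i" MoveRight] by simp
        then show ?thesis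
          using loop[OF i(2)] i by simp
      qed
      show "(if \<forall>j\<in>{p..<n}. x ! j then tree_count k (Suc r) d else 0) =
          (if ?A = {} then of_bool (Ready = Accept) else \<Sum>act\<in>?A. ?S (fst act))"
        unfolding S[symmetric] by simp
    qed (use len in \<open>auto simp: states_def conts_def fits_rewound' space_pos inj_on_def\<close>)
  qed
qed

theorem theorem3p28:
  fixes k :: nat
  assumes "k \<ge> 1"
  shows "on_unary (\<lambda>n. card (Av n k id)) \<in> sharpL"
proof (rule sharpL_I[OF wf_machine space_bigo])
  fix x :: "bool list"
  let ?n = "length x" and ?d0 = "(\<lambda>_. 0 :: nat)(0 := 1)"
  let ?dss = "replicate k ([] :: bool list)"
  have k: "0 < k" using assms by simp
  have st: "stores k ?n ?dss (\<lambda>_. 0)"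
    by (simp add: stores_def)
  have st': "stores k ?n (?dss[0 := inc (?dss ! 0)]) ?d0"
    using stores_inc[OF st, of 0] by simp
  have unary: "(\<forall>j\<in>{0..<?n}. x ! j) \<longleftrightarrow> x = replicate ?n True"
    by (subst list_eq_iff_nth_eq) auto
  have sum: "(\<Sum>l<k. ?d0 l) = Suc 0"
    using k by (simp add: sum.remove[of "{..<k}" 0])
  have ready: "certified (machine k) x (space ?n) (conf Ready (Suc 0) (rewound (?dss[0 := inc (?dss ! 0)])))
     (on_unary (\<lambda>n. card (Av n k id)) x)"
    using certified_Ready[OF st' sum refl, of ?n]
    unfolding unary on_unary_def card_Av[OF assms] by simp
  have inc: "certified (machine k) x (space ?n) (conf (Inc 0 Ready) (Suc 0)
      ((rewound ?dss)[0 := (cells (?dss ! 0), 1)])) (on_unary (\<lambda>n. card (Av n k id)) x)"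
    by (rule certified_Inc) (use k ready length_less_space[of "[]" ?n] in \<open>auto simp: conts_def\<close>)
  have "(rewound ?dss ! 0) = (cells (?dss ! 0), 0)"
    using k by (simp add: rewound_def)
  then have "certified (machine k) x (space ?n) (conf Start (Suc 0) (rewound ?dss))
      (on_unary (\<lambda>n. card (Av n k id)) x)"
    by (intro certified_step1[where q = Start and q' = "Inc 0 Ready" and i = 0 and b = 0 and d = MoveRight])
      (use k inc in \<open>auto simp: states_def fits_rewound' space_pos fun_upd_idem\<close>)
  moreover have "conf Start (Suc 0) (rewound ?dss) = init_config (machine k)"
    by (simp add: conf_def init_config_def machine_def rewound_def cells_Nil)
  ultimately show "certified (machine k) x (space ?n) (init_config (machine k))
      (on_unary (\<lambda>n. card (Av n k id)) x)"
    by simp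
qed

end
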